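(* Let $G$ be an ordered abelian group or an ordered field. Every nonempty convex subset $S$ of $G$ that is a finite union of closed bounded intervals and ultrametric balls is a bar-bell, that is, it can be written as $S=B_\alpha(a)\cup[a,b]\cup B_\beta(b)$ with $a,b\in G$, $a\le b$ and $\alpha,\beta\in uG\cup\{\infty\}$.
   Context: All orderings are total. Closed bounded intervals are the sets $[a,b]=\{x\in G\mid a\le x\le b\}$ with $a,b\in G$, $a\le b$. A subset $S\subseteq G$ is convex if $a,b\in S$ and $a\le x\le b$ imply $x\in S$. Natural valuation: for an ordered abelian group $G$ (for an ordered field, use its ordered additive group), $a,b\in G$ are archimedean equivalent if there is $n\in\mathbb{N}$ with $n|a|\ge|b|$ and $n|b|\ge|a|$. Let $va$ be the archimedean equivalence class of $a$, order the classes by $va>vb$ iff $n|a|<|b|$ for all $n\in\mathbb{N}$, i.e. iff $|a|<|b|$ and $a,b$ are not archimedean equivalent, and write $\infty:=v0$, the largest class. Put $u(a,b):=v(a-b)$ and $uG:=u(G\times G)\setminus\{\infty\}$. For $x\in G$ and $\gamma\in uG\cup\{\infty\}$, let $B_\gamma(x):=\{y\in G\mid u(x,y)\ge\gamma\}$. The ultrametric balls of $G$ are the sets $B_\gamma(x)$ with $x\in G$, $\gamma\in uG\cup\{\infty\}$ (so singletons $B_\infty(x)=\{x\}$ are included). *)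

theory Defs
  imports Main
begin

text \<open>
  Ordered abelian groups are the types of sort
  \<open>{linordered_ab_group_add, ordered_ab_group_add_abs}\<close>; the second class only provides the
  notation \<open>\<bar>x\<bar>\<close>, which its axioms determine as \<open>max x (- x)\<close>. Every \<open>linordered_field\<close> is of
  this sort, via its additive group.
\<close>

definition nmult :: "nat \<Rightarrow> 'a::comm_monoid_add \<Rightarrow> 'a" where
  "nmult n x = (\<Sum>i<n. x)"

lemma nmult_0 [simp]: "nmult 0 x = 0"
  by (simp add: nmult_def)

lemma nmult_1 [simp]: "nmult (Suc 0) x = x"
  by (simp add: nmult_def)

lemma nmult_Suc: "nmult (Suc n) x = nmult n x + x"
  by (simp add: nmult_def)

lemma nmult_zero_right [simp]: "nmult n 0 = 0"
  by (simp add: nmult_def)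

lemma nmult_add_left: "nmult (m + n) x = nmult m x + nmult n x"
  by (induction n) (simp_all add: nmult_Suc add.assoc)

lemma nmult_nmult: "nmult m (nmult n x) = nmult (m * n) x"
  by (induction m) (simp_all add: nmult_Suc nmult_add_left add.commute)

lemma nmult_mono_right: "x \<le> y \<Longrightarrow> nmult n x \<le> nmult n (y::'a::ordered_comm_monoid_add)"
  unfolding nmult_def by (rule sum_mono)

lemma nmult_mono_left: "m \<le> n \<Longrightarrow> 0 \<le> x \<Longrightarrow> nmult m x \<le> nmult n (x::'a::ordered_comm_monoid_add)"
  unfolding nmult_def by (rule sum_mono2) auto

definition arch_equiv :: "'a::{linordered_ab_group_add, ordered_ab_group_add_abs} \<Rightarrow> 'a \<Rightarrow> bool" where
  "arch_equiv a b \<longleftrightarrow> (\<exists>n. nmult n \<bar>a\<bar> \<ge> \<bar>b\<bar> \<and> nmult n \<bar>b\<bar> \<ge> \<bar>a\<bar>)"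

definition arch_less :: "'a::{linordered_ab_group_add, ordered_ab_group_add_abs} \<Rightarrow> 'a \<Rightarrow> bool" where
  "arch_less a b \<longleftrightarrow> (\<forall>n. nmult n \<bar>a\<bar> < \<bar>b\<bar>)"

lemma arch_less_iff: "arch_less a b \<longleftrightarrow> \<bar>a\<bar> < \<bar>b\<bar> \<and> \<not> arch_equiv a b"
proof
  assume l: "arch_less a b"
  have "nmult (Suc 0) \<bar>a\<bar> < \<bar>b\<bar>" using l unfolding arch_less_def by blast
  moreover have "\<not> arch_equiv a b"
    using l unfolding arch_less_def arch_equiv_def by (meson not_le)
  ultimately show "\<bar>a\<bar> < \<bar>b\<bar> \<and> \<not> arch_equiv a b" by simp
next
  assume r: "\<bar>a\<bar> < \<bar>b\<bar> \<and> \<not> arch_equiv a b"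
  show "arch_less a b"
    unfolding arch_less_def
  proof
    fix n
    show "nmult n \<bar>a\<bar> < \<bar>b\<bar>"
    proof (rule ccontr)
      assume "\<not> nmult n \<bar>a\<bar> < \<bar>b\<bar>"
      then have h: "\<bar>b\<bar> \<le> nmult n \<bar>a\<bar>" by simp
      have "nmult n \<bar>a\<bar> \<le> nmult (Suc n) \<bar>a\<bar>" by (simp add: nmult_mono_left)
      with h have h1: "\<bar>b\<bar> \<le> nmult (Suc n) \<bar>a\<bar>" by (rule order_trans)
      have "nmult (Suc 0) \<bar>b\<bar> \<le> nmult (Suc n) \<bar>b\<bar>" by (rule nmult_mono_left) auto
      then have "\<bar>b\<bar> \<le> nmult (Suc n) \<bar>b\<bar>" by simp
      with r have "\<bar>a\<bar> \<le> nmult (Suc n) \<bar>b\<bar>" by (meson less_imp_le order_trans)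
      with h1 r show False unfolding arch_equiv_def by blast
    qed
  qed
qed

lemma not_arch_less_iff: "\<not> arch_less a b \<longleftrightarrow> (\<exists>n. \<bar>b\<bar> \<le> nmult n \<bar>a\<bar>)"
  by (simp add: arch_less_def not_less)

lemma not_arch_less_trans:
  assumes "\<not> arch_less a b" "\<not> arch_less b c"
  shows "\<not> arch_less a c"
proof -
  obtain m n where m: "\<bar>b\<bar> \<le> nmult m \<bar>a\<bar>" and n: "\<bar>c\<bar> \<le> nmult n \<bar>b\<bar>"
    using assms by (auto simp: not_arch_less_iff)
  have "\<bar>c\<bar> \<le> nmult (n * m) \<bar>a\<bar>"
    using n nmult_mono_right[OF m, of n] by (simp add: nmult_nmult)
  then show ?thesis by (auto simp: not_arch_less_iff)
qed

lemma arch_equiv_iff: "arch_equiv a b \<longleftrightarrow> \<not> arch_less a b \<and> \<not> arch_less b a"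
proof
  assume "arch_equiv a b"
  then show "\<not> arch_less a b \<and> \<not> arch_less b a"
    by (auto simp: arch_equiv_def not_arch_less_iff)
next
  assume "\<not> arch_less a b \<and> \<not> arch_less b a"
  then obtain m n where m: "\<bar>b\<bar> \<le> nmult m \<bar>a\<bar>" and n: "\<bar>a\<bar> \<le> nmult n \<bar>b\<bar>"
    by (auto simp: not_arch_less_iff)
  have "\<bar>b\<bar> \<le> nmult (max m n) \<bar>a\<bar>" "\<bar>a\<bar> \<le> nmult (max m n) \<bar>b\<bar>"
    by (rule order_trans[OF m nmult_mono_left] order_trans[OF n nmult_mono_left]; simp)+
  then show "arch_equiv a b" unfolding arch_equiv_def by blast
qed

lemma arch_less_asym: "arch_less a b \<Longrightarrow> \<not> arch_less b a"
  by (auto simp: arch_less_iff)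

lemma equivp_arch_equiv:
  "equivp (arch_equiv :: 'a::{linordered_ab_group_add, ordered_ab_group_add_abs} \<Rightarrow> 'a \<Rightarrow> bool)"
proof (rule equivpI)
  show "reflp (arch_equiv :: 'a \<Rightarrow> _)"
  proof (rule reflpI)
    fix x :: 'a
    show "arch_equiv x x" unfolding arch_equiv_iff using arch_less_asym[of x x] by blast
  qed
  show "symp (arch_equiv :: 'a \<Rightarrow> _)"
    by (rule sympI) (simp add: arch_equiv_iff)
  show "transp (arch_equiv :: 'a \<Rightarrow> _)"
  proof (rule transpI)
    fix x y z :: 'a
    assume "arch_equiv x y" "arch_equiv y z"
    then show "arch_equiv x z"
      unfolding arch_equiv_iff
      using not_arch_less_trans[of x y z] not_arch_less_trans[of z y x] by blast
  qed
qed

quotient_type (overloaded) 'a arch_class =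
  "'a::{linordered_ab_group_add, ordered_ab_group_add_abs}" / arch_equiv
  morphisms rep_arch_class val
  by (rule equivp_arch_equiv)

text \<open>The larger the class, the smaller (in absolute value) its elements.\<close>

instantiation arch_class :: ("{linordered_ab_group_add, ordered_ab_group_add_abs}") linorder
begin

lift_definition less_arch_class :: "'a arch_class \<Rightarrow> 'a arch_class \<Rightarrow> bool"
  is "\<lambda>b a. arch_less a b"
proof -
  fix b b' a a' :: 'a
  assume "arch_equiv b b'" "arch_equiv a a'"
  then show "arch_less a b = arch_less a' b'"
    unfolding arch_equiv_iff
    using not_arch_less_trans[of a a' b] not_arch_less_trans[of a' b' b]
      not_arch_less_trans[of a' a b'] not_arch_less_trans[of a b b'] by blast
qed

definition less_eq_arch_class :: "'a arch_class \<Rightarrow> 'a arch_class \<Rightarrow> bool" where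
  "less_eq_arch_class x y \<longleftrightarrow> x < y \<or> x = y"

instance
proof
  fix x y z :: "'a arch_class"
  have asym: "\<not> (x < y \<and> y < x)" for x y :: "'a arch_class"
    by transfer (blast dest: arch_less_asym)
  have total: "x < y \<or> y < x \<or> x = y" for x y :: "'a arch_class"
    by transfer (unfold arch_equiv_iff, blast)
  have ntrans: "\<not> y < x \<Longrightarrow> \<not> z < y \<Longrightarrow> \<not> z < x" for x y z :: "'a arch_class"
    by transfer (rule not_arch_less_trans)
  have le: "x \<le> y \<longleftrightarrow> \<not> y < x" for x y :: "'a arch_class"
    unfolding less_eq_arch_class_def using asym[of x y] total[of x y] by blast
  show "x < y \<longleftrightarrow> x \<le> y \<and> \<not> y \<le> x" unfolding le using asym[of x y] by blast
  show "x \<le> x" by (simp add: less_eq_arch_class_def)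
  show "x \<le> y \<Longrightarrow> y \<le> z \<Longrightarrow> x \<le> z" unfolding le by (rule ntrans)
  show "x \<le> y \<Longrightarrow> y \<le> x \<Longrightarrow> x = y" unfolding le using total[of x y] by blast
  show "x \<le> y \<or> y \<le> x" unfolding le using asym[of x y] by blast
qed

end

lemma val_eq_iff: "val a = val b \<longleftrightarrow> arch_equiv a b"
  by (rule arch_class.abs_eq_iff)

lemma val_less_iff: "val a > val b \<longleftrightarrow> (\<forall>n. nmult n \<bar>a\<bar> < \<bar>b\<bar>)"
  by (simp add: less_arch_class.abs_eq arch_less_def)

definition val_infty :: "'a::{linordered_ab_group_add, ordered_ab_group_add_abs} arch_class" where
  "val_infty = val 0"

lemma le_val_infty: "x \<le> val_infty"
proof (induction x rule: arch_class.abs_induct)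
  case (1 a)
  have "\<not> arch_less a 0"
    unfolding arch_less_iff using abs_ge_zero[of a] by (simp add: not_less)
  then have "\<not> val_infty < val a"
    by (simp add: val_infty_def less_arch_class.abs_eq)
  then show ?case by (simp add: not_less)
qed

definition udist :: "'a::{linordered_ab_group_add, ordered_ab_group_add_abs} \<Rightarrow> 'a \<Rightarrow> 'a arch_class" where
  "udist a b = val (a - b)"

definition uvals :: "'a::{linordered_ab_group_add, ordered_ab_group_add_abs} arch_class set" where
  "uvals = {udist a b | a b. True} - {val_infty}"

definition uball :: "'a::{linordered_ab_group_add, ordered_ab_group_add_abs} arch_class \<Rightarrow> 'a \<Rightarrow> 'a set" where
  "uball \<gamma> x = {y. udist x y \<ge> \<gamma>}"

definition ultrametric_balls :: "'a::{linordered_ab_group_add, ordered_ab_group_add_abs} set set" where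
  "ultrametric_balls = {uball \<gamma> x | \<gamma> x. \<gamma> \<in> uvals \<union> {val_infty}}"

definition closed_bounded_intervals :: "'a::order set set" where
  "closed_bounded_intervals = {{a..b} | a b. a \<le> b}"

definition order_convex :: "'a::order set \<Rightarrow> bool" where
  "order_convex S \<longleftrightarrow> (\<forall>a b x. a \<in> S \<longrightarrow> b \<in> S \<longrightarrow> a \<le> x \<longrightarrow> x \<le> b \<longrightarrow> x \<in> S)"

definition bar_bell :: "'a::{linordered_ab_group_add, ordered_ab_group_add_abs} set \<Rightarrow> bool" where
  "bar_bell S \<longleftrightarrow> (\<exists>a b \<alpha> \<beta>. a \<le> b \<and> \<alpha> \<in> uvals \<union> {val_infty} \<and> \<beta> \<in> uvals \<union> {val_infty} \<and>
     S = uball \<alpha> a \<union> {a..b} \<union> uball \<beta> b)"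

end

(* A set of a finite family of subsets of a chain is coinitial in the union of the family, and an
   interval [c, d] is as good as the singleton ball around c for this purpose. So S contains a
   coinitial ball around some a and, dually, a cofinal ball around some b. If a <= b, convexity
   gives the bar-bell at once. Otherwise the coinitial ball contains b, and can be recentred there. *)
theory Submission
  imports Defs
begin

text \<open>Induction on the family: if the chosen \<open>A\<close> fails for the new member
  \<open>C\<close>, totality yields some \<open>c\<close> in \<open>C\<close> related to all of
  \<open>A\<close>, hence by transitivity to everything in the old union, so \<open>C\<close> takes
  over. Keeping \<open>R\<close> abstract serves both ends of the order.\<close>

lemma finite_family_coinitial:
  fixes R :: "'a \<Rightarrow> 'a \<Rightarrow> bool"
  assumes "finite F" "F \<noteq> {}"
    and "transp R" and total: "\<And>x y. R x y \<or> R y x"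
  shows "\<exists>A\<in>F. \<forall>y\<in>\<Union>F. \<exists>x\<in>A. R x y"
  using assms(1,2)
proof (induction rule: finite_ne_induct)
  case (singleton A)
  then show ?case using total by blast
next
  case (insert C F)
  then obtain A where A: "A \<in> F" "\<forall>y\<in>\<Union>F. \<exists>x\<in>A. R x y" by blast
  show ?case
  proof (cases "\<forall>y\<in>C. \<exists>x\<in>A. R x y")
    case True
    with A show ?thesis by blast
  next
    case False
    then obtain c where "c \<in> C" "\<forall>x\<in>A. R c x" using total by blast
    with A \<open>transp R\<close> have "\<forall>y\<in>\<Union>F. R c y" by (meson transpD)
    with \<open>c \<in> C\<close> total show ?thesis by blast
  qed
qed

lemma val_le_iff: "val a \<le> val b \<longleftrightarrow> (\<exists>n. \<bar>b\<bar> \<le> nmult n \<bar>a\<bar>)"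
  by (simp add: not_less[symmetric] val_less_iff)

lemma val_antimono: "\<bar>b\<bar> \<le> \<bar>a\<bar> \<Longrightarrow> val a \<le> val b"
  unfolding val_le_iff by (metis nmult_1)

text \<open>The sum is bounded by twice the larger of the two absolute values, and a factor of two
  does not change an archimedean class. This is the source of the ultrametric inequality.\<close>

lemma val_add_ge:
  assumes "\<gamma> \<le> val a" "\<gamma> \<le> val b"
  shows "\<gamma> \<le> val (a + b)"
proof -
  have *: "val x \<le> val (a + b)" if "\<bar>a\<bar> \<le> \<bar>x\<bar>" "\<bar>b\<bar> \<le> \<bar>x\<bar>" for x
  proof -
    have "\<bar>a + b\<bar> \<le> nmult (Suc (Suc 0)) \<bar>x\<bar>"
      using abs_triangle_ineq[of a b] add_mono[OF that] by (simp add: nmult_Suc)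
    then show ?thesis unfolding val_le_iff by blast
  qed
  show ?thesis
    using *[of a] *[of b] assms by (meson linear order_refl order_trans)
qed

text \<open>Every multiple of 0 is 0, so only 0 has value \<open>val_infty\<close>. This lets an
  endpoint of an interval count as a ball.\<close>

lemma uball_val_infty: "uball val_infty x = {x}"
  by (auto simp: uball_def udist_def val_infty_def val_le_iff)

lemma centre_in_uball: "x \<in> uball \<gamma> x"
  using le_val_infty[of \<gamma>] by (simp add: uball_def udist_def val_infty_def)

lemma udist_commute: "udist x y = udist y x"
  unfolding udist_def by (intro order_antisym val_antimono) (simp_all add: abs_minus_commute)

lemma udist_triangle:
  assumes "\<gamma> \<le> udist x y" "\<gamma> \<le> udist y z"
  shows "\<gamma> \<le> udist x z"
  using val_add_ge[of \<gamma> "x - y" "y - z"] assms by (simp add: udist_def)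

text \<open>By the ultrametric triangle inequality, every point of a ball is a centre of it.\<close>

lemma uball_recentre:
  assumes "y \<in> uball \<gamma> x"
  shows "uball \<gamma> y = uball \<gamma> x"
proof -
  have "\<gamma> \<le> udist x y" "\<gamma> \<le> udist y x"
    using assms by (simp_all add: uball_def udist_commute[of y x])
  then show ?thesis
    unfolding uball_def by (blast intro: udist_triangle)
qed

text \<open>Moving towards the centre shrinks the absolute difference, so the value can only
  grow.\<close>

lemma between_centre_in_uball:
  assumes "x \<in> uball \<gamma> c" "x \<le> y \<and> y \<le> c \<or> c \<le> y \<and> y \<le> x"
  shows "y \<in> uball \<gamma> c"
proof -
  have "\<bar>c - y\<bar> \<le> \<bar>c - x\<bar>"
    using assms(2) by (auto simp: abs_of_nonneg abs_of_nonpos)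
  then have "udist c x \<le> udist c y"
    unfolding udist_def by (rule val_antimono)
  with assms(1) show ?thesis by (auto simp: uball_def)
qed

lemma coinitial_uball:
  fixes S :: "'a::{linordered_ab_group_add, ordered_ab_group_add_abs} set"
  assumes "finite F" "F \<subseteq> closed_bounded_intervals \<union> ultrametric_balls" "S = \<Union>F" "S \<noteq> {}"
    and R: "R = (\<le>) \<or> R = (\<ge>)"
  shows "\<exists>\<gamma> a. \<gamma> \<in> uvals \<union> {val_infty} \<and> uball \<gamma> a \<subseteq> S \<and> (\<forall>y\<in>S. \<exists>x\<in>uball \<gamma> a. R x y)"
proof -
  have "transp R" "R x y \<or> R y x" for x y
    using R by (auto intro: transpI)
  then obtain A where A: "A \<in> F" "\<forall>y\<in>S. \<exists>x\<in>A. R x y"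
    using finite_family_coinitial[of F R] assms(1,3,4) by blast
  consider "A \<in> closed_bounded_intervals" | "A \<in> ultrametric_balls"
    using A(1) assms(2) by blast
  then show ?thesis
  proof cases
    case 1
    then obtain c d where cd: "A = {c..d}" "c \<le> d" by (auto simp: closed_bounded_intervals_def)
    \<comment> \<open>The \<open>R\<close>-first endpoint alone does the work of the whole
      interval.\<close>
    define e where "e = (if R = (\<le>) then c else d)"
    have "e \<in> A" "\<forall>x\<in>A. R e x" using cd R by (auto simp: e_def)
    then have "\<forall>y\<in>S. R e y" using A(2) \<open>transp R\<close> by (meson transpD)
    moreover have "e \<in> S" using A(1) \<open>e \<in> A\<close> assms(3) by blast
    ultimately have "uball val_infty e \<subseteq> S \<and> (\<forall>y\<in>S. \<exists>x\<in>uball val_infty e. R x y)"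
      by (simp add: uball_val_infty)
    then show ?thesis by blast
  next
    case 2
    then obtain \<gamma> a where "A = uball \<gamma> a" "\<gamma> \<in> uvals \<union> {val_infty}"
      unfolding ultrametric_balls_def by blast
    moreover have "A \<subseteq> S" using A(1) assms(3) by blast
    ultimately show ?thesis using A(2) by blast
  qed
qed

theorem mainTheorem6:
  fixes S :: "'a::{linordered_ab_group_add, ordered_ab_group_add_abs} set"
  assumes "S \<noteq> {}"
    and "order_convex S"
    and "\<exists>F. finite F \<and> F \<subseteq> closed_bounded_intervals \<union> ultrametric_balls \<and> S = \<Union>F"
  shows "bar_bell S"
proof -
  obtain F where F: "finite F" "F \<subseteq> closed_bounded_intervals \<union> ultrametric_balls" "S = \<Union>F"
    using assms(3) by blast
  obtain \<alpha> a0 where \<alpha>: "\<alpha> \<in> uvals \<union> {val_infty}"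
    and a0: "uball \<alpha> a0 \<subseteq> S" "\<forall>y\<in>S. \<exists>x\<in>uball \<alpha> a0. x \<le> y"
    using coinitial_uball[OF F assms(1), of "(\<le>)"] by blast
  obtain \<beta> b where \<beta>: "\<beta> \<in> uvals \<union> {val_infty}"
    and b: "uball \<beta> b \<subseteq> S" "\<forall>y\<in>S. \<exists>x\<in>uball \<beta> b. x \<ge> y"
    using coinitial_uball[OF F assms(1), of "(\<ge>)"] by blast
  have "b \<in> S" using b(1) centre_in_uball by blast
  obtain a where a: "uball \<alpha> a = uball \<alpha> a0" "a \<le> b"
  proof (cases "a0 \<le> b")
    case True
    with that show ?thesis by blast
  next
    case False
    obtain x where "x \<in> uball \<alpha> a0" "x \<le> b" using a0(2) \<open>b \<in> S\<close> by blast
    \<comment> \<open>Here \<open>x \<le> b < a0\<close>, so \<open>b\<close> lies between a point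
      of the ball and its centre; the choice is then \<open>a = b\<close>, and the middle interval
      degenerates to a point.\<close>
    then have "b \<in> uball \<alpha> a0" using between_centre_in_uball False by (metis linear)
    then show ?thesis using that uball_recentre by blast
  qed
  have "a \<in> S" using a(1) a0(1) centre_in_uball by blast
  have "S = uball \<alpha> a \<union> {a..b} \<union> uball \<beta> b"
  proof
    have "{a..b} \<subseteq> S"
      using \<open>a \<in> S\<close> \<open>b \<in> S\<close> assms(2) unfolding order_convex_def by (meson atLeastAtMost_iff subsetI)
    then show "uball \<alpha> a \<union> {a..b} \<union> uball \<beta> b \<subseteq> S"
      using a(1) a0(1) b(1) by simp
    show "S \<subseteq> uball \<alpha> a \<union> {a..b} \<union> uball \<beta> b"
    proof
      fix s assume "s \<in> S"
      then obtain x y where "x \<in> uball \<alpha> a" "x \<le> s" "y \<in> uball \<beta> b" "s \<le> y"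
        using a(1) a0(2) b(2) by metis
      \<comment> \<open>A point \<open>s\<close> left of \<open>a\<close> is trapped between
        \<open>x\<close> and the centre \<open>a\<close>; one right of \<open>b\<close> between the
        centre \<open>b\<close> and \<open>y\<close>. Any other \<open>s\<close> lies in
        \<open>{a..b}\<close>.\<close>
      then have "s \<le> a \<Longrightarrow> s \<in> uball \<alpha> a" "b \<le> s \<Longrightarrow> s \<in> uball \<beta> b"
        using between_centre_in_uball by blast+
      then show "s \<in> uball \<alpha> a \<union> {a..b} \<union> uball \<beta> b"
        by (metis UnI1 UnI2 atLeastAtMost_iff linear)
    qed
  qed
  with a(2) \<alpha> \<beta> show ?thesis unfolding bar_bell_def by blast
qed

end
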